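(* Fix a delay $T$ with $0<T<2\pi$. Then for every even integer $n=2,4,6,\dots$ there exists a periodic solution $x_n:\mathbb{R}\to\mathbb{R}$ of the single-well Duffing ordinary differential equation $$\ddot{x}(t)+x(t)+x(t)^3=0$$ with $x_n(0)=A_n>0$, $\dot{x}_n(0)=0$, and minimal period $p_n=2T/n$. Each of these solutions satisfies $x_n(t-T)=x_n(t)$ for all $t\in\mathbb{R}$, and is therefore also a periodic solution of the delayed Duffing equation $$\ddot{x}(t)+x(t-T)+x(t)^3=0,\qquad t\in\mathbb{R}.$$ Moreover, the amplitudes $A_n=\max_{t}|x_n(t)|$ increase with $n$ (over even $n$) and are unbounded: $A_n\nearrow\infty$ as $n\to\infty$.
   Context: The minimal period of a nonconstant periodic function is its smallest positive period. *)

theory Defs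
  imports "HOL-Analysis.Analysis" "HOL-Library.Periodic_Fun"
begin

text \<open>
  The library operator \<^const>\<open>deriv\<close> is total, so the existence of the derivatives occurring
  in an equation has to be demanded separately.
\<close>

definition twice_differentiable :: "(real \<Rightarrow> real) \<Rightarrow> bool" where
  "twice_differentiable x \<longleftrightarrow>
     (\<forall>t. x differentiable (at t)) \<and> (\<forall>t. deriv x differentiable (at t))"

definition duffing_solution :: "(real \<Rightarrow> real) \<Rightarrow> bool" where
  "duffing_solution x \<longleftrightarrow>
     twice_differentiable x \<and> (\<forall>t. deriv (deriv x) t + x t + x t ^ 3 = 0)"

definition delayed_duffing_solution :: "real \<Rightarrow> (real \<Rightarrow> real) \<Rightarrow> bool" where
  "delayed_duffing_solution T x \<longleftrightarrow>
     twice_differentiable x \<and> (\<forall>t. deriv (deriv x) t + x (t - T) + x t ^ 3 = 0)"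

definition is_minimal_period :: "(real \<Rightarrow> real) \<Rightarrow> real \<Rightarrow> bool" where
  "is_minimal_period x p \<longleftrightarrow>
     \<not> x constant_on UNIV \<and> 0 < p \<and> periodic_fun_simple x p \<and>
     (\<forall>q. 0 < q \<and> periodic_fun_simple x q \<longrightarrow> p \<le> q)"

end

theory Submission
  imports Defs
begin

text \<open>
  Writing \<open>x = a cos \<phi>\<close>, the energy identity
  \<open>x'\<^sup>2 + x\<^sup>2 + x\<^sup>4 / 2 = a\<^sup>2 + a\<^sup>4 / 2\<close> becomes the autonomous first-order equation
  \<open>\<phi>' = sqrt (1 + a\<^sup>2 (1 + cos\<^sup>2 \<phi>) / 2)\<close>, whose right-hand side never vanishes and is
  \<open>2 \<pi>\<close>-periodic.  Hence \<open>\<phi>\<close> is the inverse function of an antiderivative of the reciprocal of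
  that right-hand side, and the minimal period of \<open>x\<close> is the integral of this reciprocal
  over \<open>[0, 2 \<pi>]\<close>.  The integral is continuous and strictly decreasing in \<open>a\<close>, equals \<open>2 \<pi>\<close> at
  \<open>a = 0\<close> and tends to \<open>0\<close>, so it takes each value \<open>2 T / n\<close> exactly once.
\<close>

section \<open>The angular speed: bounds, symmetry and regularity\<close>

definition angular_speed :: "real \<Rightarrow> real \<Rightarrow> real" where
  "angular_speed a \<theta> = sqrt (1 + a\<^sup>2 * (1 + (cos \<theta>)\<^sup>2) / 2)"

definition duffing_period :: "real \<Rightarrow> real" where
  "duffing_period a = integral {0..2 * pi} (\<lambda>\<theta>. 1 / angular_speed a \<theta>)"

lemma angular_speed_radicand_ge: "1 + a\<^sup>2 / 2 \<le> 1 + a\<^sup>2 * (1 + (cos \<theta>)\<^sup>2) / (2::real)"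
proof -
  have "a\<^sup>2 * 1 \<le> a\<^sup>2 * (1 + (cos \<theta>)\<^sup>2)"
    by (intro mult_left_mono) auto
  then show ?thesis by simp
qed

lemma angular_speed_radicand_pos: "0 < 1 + a\<^sup>2 * (1 + (cos \<theta>)\<^sup>2) / (2::real)"
  using angular_speed_radicand_ge[of a \<theta>] zero_le_power2[of a] by linarith

lemma angular_speed_pos: "0 < angular_speed a \<theta>"
  unfolding angular_speed_def using angular_speed_radicand_pos by simp

lemma angular_speed_ge: "sqrt (1 + a\<^sup>2 / 2) \<le> angular_speed a \<theta>"
  unfolding angular_speed_def using angular_speed_radicand_ge by simp

lemma angular_speed_le: "angular_speed a \<theta> \<le> sqrt (1 + a\<^sup>2)"
proof -
  have "a\<^sup>2 * (1 + (cos \<theta>)\<^sup>2) \<le> a\<^sup>2 * 2"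
    by (intro mult_left_mono) (auto simp: abs_square_le_1)
  then show ?thesis by (simp add: angular_speed_def)
qed

lemma angular_speed_power2: "(angular_speed a \<theta>)\<^sup>2 = 1 + a\<^sup>2 * (1 + (cos \<theta>)\<^sup>2) / 2"
  unfolding angular_speed_def using angular_speed_radicand_pos[of a \<theta>] by (simp add: less_imp_le)

lemma angular_speed_add_2pi: "angular_speed a (\<theta> + 2 * pi) = angular_speed a \<theta>"
  by (simp add: angular_speed_def)

lemma angular_speed_strict_mono:
  assumes "0 \<le> a" "a < b"
  shows "angular_speed a \<theta> < angular_speed b \<theta>"
proof -
  have "a\<^sup>2 < b\<^sup>2"
    using assms by (intro power_strict_mono) auto
  moreover have "0 < 1 + (cos \<theta>)\<^sup>2"
    by (simp add: add_pos_nonneg)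
  ultimately have "a\<^sup>2 * (1 + (cos \<theta>)\<^sup>2) < b\<^sup>2 * (1 + (cos \<theta>)\<^sup>2)"
    by (rule mult_strict_right_mono)
  then show ?thesis by (simp add: angular_speed_def)
qed

lemma DERIV_angular_speed:
  "(angular_speed a has_real_derivative - (a\<^sup>2 * cos \<theta> * sin \<theta>) / (2 * angular_speed a \<theta>)) (at \<theta>)"
  unfolding angular_speed_def[abs_def]
  using angular_speed_radicand_pos[of a \<theta>]
  by (auto intro!: derivative_eq_intros simp: field_simps)

lemma continuous_inverse_angular_speed:
  "continuous_on S (\<lambda>\<theta>. 1 / angular_speed a \<theta>)"
proof -
  have "continuous_on S (angular_speed a)"
    by (rule DERIV_continuous_on) (rule has_field_derivative_at_within[OF DERIV_angular_speed])
  then show ?thesis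
    using angular_speed_pos[of a] by (intro continuous_on_divide continuous_on_const) (auto simp: less_le)
qed

section \<open>The angle as a function of time, and the solution built from it\<close>

lemma duffing_angle_exists:
  obtains \<phi> :: "real \<Rightarrow> real" where
    "\<phi> 0 = 0" "\<And>t. (\<phi> has_real_derivative angular_speed a (\<phi> t)) (at t)"
    "\<And>t. \<phi> (t + duffing_period a) = \<phi> t + 2 * pi"
    "0 < duffing_period a" "\<phi> (duffing_period a) = 2 * pi"
proof -
  let ?w = "\<lambda>\<theta>. 1 / angular_speed a \<theta>"
  \<comment> \<open>Infinite end points give an antiderivative on the whole line, so that time runs
    in both directions.\<close>
  have "\<exists>F. \<forall>x. -\<infinity> < ereal x \<longrightarrow> ereal x < \<infinity> \<longrightarrow> (F has_vector_derivative ?w x) (at x)"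
    by (rule einterval_antiderivative)
       (use continuous_inverse_angular_speed[of UNIV a] in \<open>auto simp: continuous_on_eq_continuous_at\<close>)
  then obtain F where F: "\<And>x. (F has_vector_derivative ?w x) (at x)"
    by auto
  define \<tau> where "\<tau> x = F x - F 0" for x
  have D: "(\<tau> has_real_derivative ?w x) (at x)" for x
    unfolding \<tau>_def
    by (rule derivative_eq_intros F[unfolded has_real_derivative_iff_has_vector_derivative[symmetric]] refl)+ simp
  have cont: "continuous_on S \<tau>" for S
    by (rule DERIV_continuous_on) (rule has_field_derivative_at_within[OF D])
  have \<tau>0: "\<tau> 0 = 0" by (simp add: \<tau>_def)
  have w_pos: "0 < ?w \<theta>" for \<theta>
    using angular_speed_pos by simp
  have mono: "strict_mono \<tau>"
  proof (rule strict_monoI, rule DERIV_pos_imp_increasing[where f = \<tau>])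
    show "\<exists>d. (\<tau> has_real_derivative d) (at z) \<and> 0 < d" for z
      using D[of z] w_pos by blast
  qed
  \<comment> \<open>A positive lower bound of the integrand, coming from the upper bound on the
    speed. It makes \<open>\<tau>\<close> grow at least linearly, hence onto, so that its inverse
    exists for all times.\<close>
  define c where "c = 1 / sqrt (1 + a\<^sup>2)"
  have c_pos: "0 < c"
    unfolding c_def by (simp add: add_pos_nonneg)
  have c_le: "c \<le> ?w \<theta>" for \<theta>
    unfolding c_def using angular_speed_le angular_speed_pos by (simp add: frac_le)
  have growth: "\<tau> x - c * x \<le> \<tau> y - c * y" if "x \<le> y" for x y
  proof (rule DERIV_nonneg_imp_nondecreasing[OF that])
    fix z
    have "((\<lambda>x. \<tau> x - c * x) has_real_derivative ?w z - c) (at z)"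
      by (auto intro!: derivative_eq_intros D)
    then show "\<exists>d. ((\<lambda>x. \<tau> x - c * x) has_real_derivative d) (at z) \<and> 0 \<le> d"
      using c_le[of z] by (intro exI conjI) auto
  qed
  have "\<exists>x. \<tau> x = y" for y
  proof -
    \<comment> \<open>By \<open>growth\<close> and \<open>\<tau> 0 = 0\<close>,
      \<open>\<tau> b\<close> is at least \<open>c * b = \<bar>y\<bar>\<close> and
      \<open>\<tau> (- b)\<close> at most \<open>- \<bar>y\<bar>\<close>, so \<open>y\<close> lies
      between the two values.\<close>
    define b where "b = \<bar>y\<bar> / c"
    have "0 \<le> b" "c * b = \<bar>y\<bar>"
      using c_pos by (auto simp: b_def)
    then have "\<tau> (- b) \<le> y" "y \<le> \<tau> b"
      using growth[of 0 b] growth[of "-b" 0] \<tau>0 by auto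
    then show ?thesis
      using IVT'[of \<tau> "-b" y b] \<open>0 \<le> b\<close> cont by auto
  qed
  then obtain \<phi> where \<phi>: "\<tau> (\<phi> y) = y" for y
    by metis
  have \<phi>_left: "\<phi> (\<tau> x) = x" for x
    using \<phi> strict_mono_eq[OF mono] by blast
  have \<phi>_cont: "isCont \<phi> t" for t
    using isCont_inverse_function[of 1 "\<phi> t" \<phi> \<tau>] \<phi> \<phi>_left cont[of UNIV]
    by (auto simp: continuous_on_eq_continuous_at)
  have \<phi>_D: "(\<phi> has_real_derivative angular_speed a (\<phi> t)) (at t)" for t
    using DERIV_inverse_function[of \<tau> "?w (\<phi> t)" \<phi> t "t - 1" "t + 1"] D \<phi> \<phi>_cont w_pos[of "\<phi> t"]
    by (simp add: inverse_eq_divide less_le)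
  have "(?w has_integral \<tau> (2 * pi) - \<tau> 0) {0..2 * pi}"
    using D by (intro fundamental_theorem_of_calculus)
      (auto simp flip: has_real_derivative_iff_has_vector_derivative intro: DERIV_subset)
  then have P: "duffing_period a = \<tau> (2 * pi)"
    by (simp add: duffing_period_def integral_unique \<tau>0)
  have \<tau>_shift: "\<tau> (x + 2 * pi) = \<tau> x + duffing_period a" for x
  proof -
    \<comment> \<open>The integrand is \<open>2 * pi\<close>-periodic, so the time needed for one
      full turn does not depend on the starting angle.\<close>
    have "((\<lambda>x. \<tau> (x + 2 * pi) - \<tau> x) has_real_derivative 0) (at z)" for z
      using DERIV_shift[THEN iffD1, OF D[of "z + 2 * pi"]] D[of z]
      by (auto intro!: derivative_eq_intros simp: angular_speed_add_2pi)
    then have "\<tau> (x + 2 * pi) - \<tau> x = \<tau> (0 + 2 * pi) - \<tau> 0"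
      using DERIV_isconst_all by blast
    then show ?thesis by (simp add: P \<tau>0)
  qed
  show thesis
  proof
    show "\<phi> 0 = 0" using \<phi>_left[of 0] \<tau>0 by simp
    show "\<phi> (t + duffing_period a) = \<phi> t + 2 * pi" for t
      using \<phi>_left[of "\<phi> t + 2 * pi"] by (simp add: \<tau>_shift \<phi>)
    show "0 < duffing_period a"
      using strict_monoD[OF mono, of 0 "2 * pi"] by (simp add: P \<tau>0)
    show "\<phi> (duffing_period a) = 2 * pi"
      by (simp add: P \<phi>_left)
  qed (rule \<phi>_D)
qed

lemma duffing_solution_exists:
  assumes "0 < a"
  obtains x where
    "duffing_solution x" "x 0 = a" "deriv x 0 = 0" "\<And>t. \<bar>x t\<bar> \<le> a"
    "is_minimal_period x (duffing_period a)"
proof -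
  obtain \<phi> where \<phi>0: "\<phi> 0 = 0"
    and D: "\<And>t. (\<phi> has_real_derivative angular_speed a (\<phi> t)) (at t)"
    and shift: "\<And>t. \<phi> (t + duffing_period a) = \<phi> t + 2 * pi"
    and P_pos: "0 < duffing_period a" and P: "\<phi> (duffing_period a) = 2 * pi"
    by (rule duffing_angle_exists[of a]) blast
  define x where "x t = a * cos (\<phi> t)" for t
  define v where "v t = - (a * sin (\<phi> t) * angular_speed a (\<phi> t))" for t
  have x_D: "(x has_real_derivative v t) (at t)" for t
    unfolding x_def v_def by (auto intro!: derivative_eq_intros D)
  have v_D: "(v has_real_derivative - x t - x t ^ 3) (at t)" for t
  proof -
    let ?c = "cos (\<phi> t)" and ?s = "sin (\<phi> t)" and ?w = "angular_speed a (\<phi> t)"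
    have w: "?w \<noteq> 0" using angular_speed_pos[of a "\<phi> t"] by simp
    \<comment> \<open>The derivative of the speed has \<open>?w\<close> in its denominator, while
      the chain rule contributes a factor \<open>?w\<close> from \<phi>; the two cancel in the next
      step.\<close>
    have "(v has_real_derivative
        - (a * ?c * ?w * ?w + a * ?s * (- (a\<^sup>2 * ?c * ?s) / (2 * ?w) * ?w))) (at t)"
      unfolding v_def
      by (auto intro!: derivative_eq_intros D DERIV_chain2[OF DERIV_angular_speed D])
    also have "- (a * ?c * ?w * ?w + a * ?s * (- (a\<^sup>2 * ?c * ?s) / (2 * ?w) * ?w))
        = - (a * ?c * ?w\<^sup>2) + a ^ 3 * ?c * ?s\<^sup>2 / 2"
      using w by (simp add: power2_eq_square power3_eq_cube)
    \<comment> \<open>After inserting the radicand for \<open>?w\<^sup>2\<close> and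
      \<open>1 - ?c\<^sup>2\<close> for \<open>?s\<^sup>2\<close>, the terms
      \<open>a ^ 3 * ?c / 2\<close> cancel and the two halves of the cubic term add up.\<close>
    also have "\<dots> = - x t - x t ^ 3"
      by (simp add: angular_speed_power2 x_def sin_squared_eq)
         (simp add: field_simps power2_eq_square power3_eq_cube)
    finally show ?thesis .
  qed
  have deriv_x: "deriv x = v"
    using DERIV_imp_deriv[OF x_D] by auto
  have deriv_v: "deriv v t = - x t - x t ^ 3" for t
    using DERIV_imp_deriv[OF v_D] .
  have phi_mono: "strict_mono \<phi>"
  proof (rule strict_monoI, rule DERIV_pos_imp_increasing[where f = \<phi>])
    show "\<exists>d. (\<phi> has_real_derivative d) (at z) \<and> 0 < d" for z
      using D[of z] angular_speed_pos by blast
  qed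
  have period: "periodic_fun_simple x (duffing_period a)"
    by standard (simp add: x_def shift)
  have minimal: "duffing_period a \<le> q" if "0 < q" "periodic_fun_simple x q" for q
  proof -
    interpret periodic_fun_simple x q by fact
    \<comment> \<open>A period brings \<open>x\<close> back to its initial value \<open>a\<close>,
      which is attained only at whole turns. As \<phi> increases from 0, at least one full turn has
      been made by time \<open>q\<close>.\<close>
    have "cos (\<phi> q) = 1"
      using plus_period[of 0] \<open>0 < a\<close> by (simp add: x_def \<phi>0)
    then obtain k :: int where k: "\<phi> q = of_int k * 2 * pi"
      using cos_one_2pi_int by auto
    have "0 < \<phi> q"
      using strict_monoD[OF phi_mono that(1)] \<phi>0 by simp
    then have "1 \<le> k"
      by (simp add: k zero_less_mult_iff)
    then have "\<phi> (duffing_period a) \<le> \<phi> q"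
      by (simp add: k P)
    then show ?thesis
      by (simp add: strict_mono_less_eq[OF phi_mono])
  qed
  have "\<not> x constant_on UNIV"
  proof
    assume "x constant_on UNIV"
    \<comment> \<open>A constant function would have half the minimal period as a period
      too.\<close>
    then have "periodic_fun_simple x (duffing_period a / 2)"
      by unfold_locales (auto simp: constant_on_def)
    then show False using minimal[of "duffing_period a / 2"] P_pos by auto
  qed
  then have "is_minimal_period x (duffing_period a)"
    unfolding is_minimal_period_def using P_pos period minimal by blast
  moreover have "duffing_solution x"
    unfolding duffing_solution_def twice_differentiable_def deriv_x
    using x_D v_D by (auto simp: deriv_v real_differentiable_def)
  moreover have "x 0 = a" "deriv x 0 = 0"
    by (auto simp: x_def deriv_x v_def \<phi>0)
  moreover have "\<bar>x t\<bar> \<le> a" for t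
    using \<open>0 < a\<close> abs_cos_le_one[of "\<phi> t"] by (simp add: x_def abs_mult mult_left_le)
  ultimately show thesis using that by blast
qed

section \<open>Dependence of the period on the amplitude\<close>

lemma duffing_period_0: "duffing_period 0 = 2 * pi"
  by (simp add: duffing_period_def angular_speed_def)

lemma duffing_period_strict_antimono:
  assumes "0 \<le> a" "a < b"
  shows "duffing_period b < duffing_period a"
  unfolding duffing_period_def
proof (rule integral_less_real)
  show "1 / angular_speed b \<theta> < 1 / angular_speed a \<theta>" for \<theta>
    using angular_speed_strict_mono[OF assms] angular_speed_pos
    by (intro divide_strict_left_mono mult_pos_pos) auto
qed (auto intro: continuous_inverse_angular_speed simp: not_le)

text \<open>Comparing amplitudes thus reduces to comparing periods, which are known explicitly for
  the chosen solutions.\<close>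

lemma duffing_period_less_iff:
  assumes "0 \<le> a" "0 \<le> b"
  shows "duffing_period b < duffing_period a \<longleftrightarrow> a < b"
  using duffing_period_strict_antimono assms by (metis less_asym linorder_neqE_linordered_idom)

lemma continuous_on_duffing_period: "continuous_on S duffing_period"
proof -
  have nz: "sqrt (1 + a\<^sup>2 * (1 + (cos \<theta>)\<^sup>2) / 2) \<noteq> 0" for a \<theta> :: real
    using angular_speed_pos[of a \<theta>] by (simp add: angular_speed_def)
  have "continuous_on (S \<times> cbox 0 (2 * pi)) (\<lambda>(a, \<theta>). 1 / angular_speed a \<theta>)"
    unfolding case_prod_unfold angular_speed_def
    by (intro continuous_intros ballI nz) simp
  from integral_continuous_on_param[OF this] show ?thesis
    by (simp add: duffing_period_def[abs_def])
qed

text \<open>Bounding the speed below by its value at \<open>cos \<theta> = 0\<close> gives decay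
  like \<open>1 / a\<close>, enough to push the period below any positive number.\<close>

lemma duffing_period_le: "duffing_period a \<le> 2 * pi / sqrt (1 + a\<^sup>2 / 2)"
proof -
  have "integral {0..2 * pi} (\<lambda>\<theta>. 1 / angular_speed a \<theta>)
      \<le> integral {0..2 * pi} (\<lambda>\<theta>. 1 / sqrt (1 + a\<^sup>2 / 2))"
  proof (rule integral_le)
    have "0 < sqrt (1 + a\<^sup>2 / 2)"
      by (simp add: add_pos_nonneg)
    then show "1 / angular_speed a \<theta> \<le> 1 / sqrt (1 + a\<^sup>2 / 2)" for \<theta>
      using angular_speed_ge angular_speed_pos by (intro divide_left_mono mult_pos_pos) auto
  qed (auto intro!: integrable_continuous_real continuous_inverse_angular_speed)
  then show ?thesis by (simp add: duffing_period_def)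
qed

lemma duffing_period_surj:
  assumes "0 < p" "p < 2 * pi"
  obtains a where "0 < a" "duffing_period a = p"
proof -
  \<comment> \<open>Chosen so that the weaker bound \<open>2 * pi / (b / 2)\<close> on the period is
    exactly \<open>p\<close>. The intermediate value theorem then applies on \<open>{0..b}\<close>,
    since the period at 0 is \<open>2 * pi\<close>.\<close>
  define b where "b = 4 * pi / p"
  have "0 < b" using assms by (simp add: b_def)
  have "b / 2 \<le> sqrt (1 + b\<^sup>2 / 2)"
    by (rule real_le_rsqrt) (simp add: power_divide)
  then have "2 * pi / sqrt (1 + b\<^sup>2 / 2) \<le> 2 * pi / (b / 2)"
    using \<open>0 < b\<close> by (intro divide_left_mono mult_pos_pos) (auto intro!: add_pos_nonneg)
  also have "\<dots> = p" using assms by (simp add: b_def)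
  finally have "duffing_period b \<le> p"
    using duffing_period_le[of b] by simp
  then obtain a where a: "0 \<le> a" "duffing_period a = p"
    using IVT2'[of duffing_period b p 0] assms \<open>0 < b\<close> continuous_on_duffing_period
    by (auto simp: duffing_period_0)
  then have "a \<noteq> 0" using assms duffing_period_0 by auto
  with a show thesis by (intro that[of a]) simp_all
qed

section \<open>Choice of the amplitudes, the delay identity and the growth of the amplitudes\<close>

theorem mainTheorem2:
  fixes T :: real
  assumes "0 < T" and "T < 2 * pi"
  shows "\<exists>(x :: nat \<Rightarrow> real \<Rightarrow> real) (A :: nat \<Rightarrow> real).
    (\<forall>n. even n \<and> 2 \<le> n \<longrightarrow>
       duffing_solution (x n) \<and>
       x n 0 = A n \<and> 0 < A n \<and> deriv (x n) 0 = 0 \<and>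
       is_minimal_period (x n) (2 * T / real n) \<and>
       (\<forall>t. x n (t - T) = x n t) \<and>
       delayed_duffing_solution T (x n) \<and>
       (\<exists>s. \<bar>x n s\<bar> = A n) \<and> (\<forall>t. \<bar>x n t\<bar> \<le> A n)) \<and>
    strict_mono_on {n. even n \<and> 2 \<le> n} A \<and>
    filterlim (\<lambda>k. A (2 * k)) at_top sequentially"
proof -
  have "\<exists>a. 0 < a \<and> duffing_period a = 2 * T / real n" if "2 \<le> n" for n :: nat
  proof -
    \<comment> \<open>With \<open>T < 2 * pi\<close> this puts the required period in the range of
      \<open>duffing_period\<close> over positive amplitudes.\<close>
    have "2 * T / real n \<le> T"
      using that assms by (simp add: field_simps)
    then show ?thesis
      using duffing_period_surj[of "2 * T / real n"] that assms by force
  qed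
  then obtain A where A: "\<And>n. 2 \<le> n \<Longrightarrow> 0 < A n \<and> duffing_period (A n) = 2 * T / real n"
    by metis
  have "\<exists>x. duffing_solution x \<and> x 0 = A n \<and> deriv x 0 = 0 \<and> (\<forall>t. \<bar>x t\<bar> \<le> A n) \<and>
      is_minimal_period x (2 * T / real n)" if "2 \<le> n" for n
    using duffing_solution_exists[of "A n"] A[OF that] by metis
  then obtain x where x: "\<And>n. 2 \<le> n \<Longrightarrow> duffing_solution (x n) \<and> x n 0 = A n \<and>
      deriv (x n) 0 = 0 \<and> (\<forall>t. \<bar>x n t\<bar> \<le> A n) \<and> is_minimal_period (x n) (2 * T / real n)"
    by metis
  have delay: "x n (t - T) = x n t" if n: "even n" "2 \<le> n" for n t
  proof -
    interpret periodic_fun_simple "x n" "2 * T / real n"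
      using x[OF n(2)] by (simp add: is_minimal_period_def)
    \<comment> \<open>Evenness enters here: the delay is a whole number of periods, namely
      \<open>n div 2\<close>.\<close>
    have "real (n div 2) * (2 * T / real n) = T"
      using n by (simp add: real_of_nat_div)
    then show ?thesis
      using minus_of_nat[of t "n div 2"] by simp
  qed
  have "strict_mono_on {n. even n \<and> 2 \<le> n} A"
  proof (rule strict_mono_onI)
    fix m n :: nat assume *: "m \<in> {n. even n \<and> 2 \<le> n}" "n \<in> {n. even n \<and> 2 \<le> n}" "m < n"
    then have "2 * T / real n < 2 * T / real m"
      using assms by (intro divide_strict_left_mono) auto
    then show "A m < A n"
      using * A[of m] A[of n] duffing_period_less_iff[of "A m" "A n"] by auto
  qed
  moreover have "filterlim (\<lambda>k. A (2 * k)) at_top sequentially"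
    unfolding filterlim_at_top_gt[where c = 0]
  proof (intro allI impI)
    fix M :: real assume "0 < M"
    \<comment> \<open>\<open>T / real k\<close> is the period belonging to \<open>A (2 * k)\<close>.
      Once it drops below the period at amplitude \<open>M\<close>, antitonicity forces the
      amplitude above \<open>M\<close>.\<close>
    have "(\<lambda>k. T / real k) \<longlonglongrightarrow> 0"
      by (rule lim_const_over_n)
    moreover have "0 < duffing_period M"
      by (rule duffing_angle_exists)
    ultimately have "\<forall>\<^sub>F k in sequentially. T / real k < duffing_period M"
      by (rule order_tendstoD)
    then show "\<forall>\<^sub>F k in sequentially. M \<le> A (2 * k)"
      using eventually_ge_at_top[of 1]
    proof eventually_elim
      case (elim k)
      then show ?case
        using A[of "2 * k"] duffing_period_less_iff[of M "A (2 * k)"] \<open>0 < M\<close> by auto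
    qed
  qed
  moreover have "delayed_duffing_solution T (x n)" if "even n" "2 \<le> n" for n
    using x[OF that(2)] delay[OF that]
    by (simp add: duffing_solution_def delayed_duffing_solution_def)
  moreover have "\<exists>s. \<bar>x n s\<bar> = A n" if "2 \<le> n" for n
    using x[OF that] A[OF that] by (intro exI[of _ 0]) simp
  ultimately show ?thesis
    using x A delay by (intro exI[of _ x] exI[of _ A]) simp
qed

end
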